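(* (a) For every $v\geq 8$ there exists a connected symmetric configuration $v_3$ whose minimum blocking set cardinality is exactly $\lceil v/3\rceil+1$. (b) For $v=12$ and for every $v\geq 15$ there exists a connected symmetric configuration $v_3$ whose minimum blocking set cardinality is exactly $\lceil v/3\rceil+2$.
   Context: A symmetric configuration $v_3$ consists of a set of $v$ points and a collection of $v$ blocks, each block being a 3-element subset of the points, such that every point lies in exactly 3 blocks and any two distinct points lie in at most one common block. It is connected if it is not the union of two configurations on disjoint nonempty point sets. A blocking set is a subset $Q$ of the points such that every block contains at least one point of $Q$ and at least one point not in $Q$. The minimum blocking set cardinality of a configuration is the smallest cardinality of a blocking set of it (assuming one exists). *)

theory Defs
  imports Complex_Main
begin

text \<open>A symmetric configuration v_3 on point set P with block set B.
  Blocks form a set (repeated blocks are impossible anyway, since two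
  distinct points lie in at most one common block).\<close>
definition sym_config_v3 :: "'a set \<Rightarrow> 'a set set \<Rightarrow> nat \<Rightarrow> bool" where
  "sym_config_v3 P B v \<longleftrightarrow>
     finite P \<and> card P = v \<and> finite B \<and> card B = v \<and>
     (\<forall>b\<in>B. b \<subseteq> P \<and> card b = 3) \<and>
     (\<forall>p\<in>P. card {b\<in>B. p \<in> b} = 3) \<and>
     (\<forall>p\<in>P. \<forall>q\<in>P. p \<noteq> q \<longrightarrow> card {b\<in>B. p \<in> b \<and> q \<in> b} \<le> 1)"

text \<open>Connected: not the union of two configurations on disjoint nonempty point sets,
  i.e. there is no splitting of P into two disjoint nonempty parts such that every block
  lies inside one of the parts.\<close>
definition config_connected :: "'a set \<Rightarrow> 'a set set \<Rightarrow> bool" where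
  "config_connected P B \<longleftrightarrow>
     \<not> (\<exists>P1 P2. P1 \<noteq> {} \<and> P2 \<noteq> {} \<and> P1 \<inter> P2 = {} \<and> P1 \<union> P2 = P \<and>
                (\<forall>b\<in>B. b \<subseteq> P1 \<or> b \<subseteq> P2))"

definition blocking_set :: "'a set \<Rightarrow> 'a set set \<Rightarrow> 'a set \<Rightarrow> bool" where
  "blocking_set P B Q \<longleftrightarrow> Q \<subseteq> P \<and> (\<forall>b\<in>B. b \<inter> Q \<noteq> {} \<and> b - Q \<noteq> {})"

definition min_blocking_card :: "'a set \<Rightarrow> 'a set set \<Rightarrow> nat \<Rightarrow> bool" where
  "min_blocking_card P B k \<longleftrightarrow>
     (\<exists>Q. blocking_set P B Q \<and> card Q = k) \<and>
     (\<forall>Q. blocking_set P B Q \<longrightarrow> k \<le> card Q)"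

end

theory Submission
  imports Defs
begin

text \<open>
  Call a block heavy for a blocking set \<open>Q\<close> if it contains two points of \<open>Q\<close>. Counting
  incidences gives \<open>3 * card Q = v + h\<close> with \<open>h\<close> the number of heavy blocks, so a lower bound on
  the size of a blocking set is a lower bound on \<open>h\<close>. If some set \<open>L\<close> of blocks already forces
  \<open>k\<close> heavy blocks among its members, the bound survives every change of the configuration
  outside \<open>L\<close>.

  Three pairwise disjoint blocks outside \<open>L\<close> can be traded for six: each block \<open>A\<close> exchanges one
  of its points \<open>u A\<close> for a new point \<open>p A\<close>, and \<open>u A\<close> forms a block with the new points of the
  other two. If \<open>u A \<in> Q\<close> for exactly one \<open>A\<close>, then adding its \<open>p A\<close> to \<open>Q\<close> gives a blocking
  set again. The exchanged blocks are still pairwise disjoint, so the step can be iterated. As it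
  adds 3 to \<open>v\<close> and 1 to the minimum, one base configuration for each residue of \<open>v\<close> modulo 3
  suffices, together with finitely many small configurations. These were found by simulated
  annealing, and their forced heavy blocks are verified by exhaustive search.
\<close>

section \<open>Incidences and connectivity\<close>

lemma sum_card_Int_eq_mult_card:
  assumes "finite B" "finite Q" and degree: "\<And>p. p \<in> Q \<Longrightarrow> card {b \<in> B. p \<in> b} = r"
  shows "(\<Sum>b\<in>B. card (b \<inter> Q)) = r * card Q"
proof -
  have "b \<inter> Q = {p \<in> Q. p \<in> b}" for b by blast
  with assms show ?thesis
    using sum_multicount[of B Q "\<lambda>b p. p \<in> b" r] by simp
qed

lemma card_common_blocks_le_1_iff:
  assumes "finite P" "B \<subseteq> Pow P"
  shows "(\<forall>p\<in>P. \<forall>q\<in>P. p \<noteq> q \<longrightarrow> card {b \<in> B. p \<in> b \<and> q \<in> b} \<le> 1) \<longleftrightarrow>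
    (\<forall>b\<in>B. \<forall>b'\<in>B. b \<noteq> b' \<longrightarrow> card (b \<inter> b') \<le> 1)"
proof -
  have "finite B" using assms by (meson finite_Pow_iff finite_subset)
  moreover have "finite (b \<inter> b')" if "b \<in> B" for b b'
    using assms that by (meson PowD finite_Int finite_subset subsetD)
  ultimately show ?thesis
    using assms(2) unfolding One_nat_def by (simp add: card_le_Suc0_iff_eq) blast
qed

lemma sym_config_v3_iff:
  "sym_config_v3 P B v \<longleftrightarrow> finite P \<and> card P = v \<and> B \<subseteq> Pow P \<and> (\<forall>b\<in>B. card b = 3) \<and>
    (\<forall>p\<in>P. card {b \<in> B. p \<in> b} = 3) \<and> (\<forall>b\<in>B. \<forall>b'\<in>B. b \<noteq> b' \<longrightarrow> card (b \<inter> b') \<le> 1)"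
proof (cases "finite P \<and> B \<subseteq> Pow P")
  case True
  then have fin: "finite P" "finite B"
    by (meson finite_Pow_iff finite_subset)+
  have "card B = card P"
    if size: "\<forall>b\<in>B. card b = 3" and degree: "\<forall>p\<in>P. card {b \<in> B. p \<in> b} = 3"
  proof -
    have "3 * card B = (\<Sum>b\<in>B. card b)" using size by simp
    also have "\<dots> = (\<Sum>b\<in>B. card (b \<inter> P))"
      using True by (intro sum.cong) (auto simp: Int_absorb2)
    also have "\<dots> = 3 * card P"
      using fin degree by (intro sum_card_Int_eq_mult_card) auto
    finally show ?thesis by simp
  qed
  moreover have "\<forall>b\<in>B. b \<subseteq> P" using True by blast
  ultimately show ?thesis
    using True fin card_common_blocks_le_1_iff[of P B]
    by (auto simp only: sym_config_v3_def ball_conj_distrib)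
qed (auto simp: sym_config_v3_def)

definition closed_under_blocks :: "'a set set \<Rightarrow> 'a set \<Rightarrow> bool" where
  "closed_under_blocks B X \<longleftrightarrow> (\<forall>b\<in>B. b \<inter> X \<noteq> {} \<longrightarrow> b \<subseteq> X)"

lemma closed_under_blocks_iff:
  "closed_under_blocks B X \<longleftrightarrow> (\<forall>b\<in>B. \<forall>p\<in>b. \<forall>q\<in>b. p \<in> X \<longleftrightarrow> q \<in> X)"
  unfolding closed_under_blocks_def by blast

lemma config_connected_iff:
  assumes "B \<subseteq> Pow P"
  shows "config_connected P B \<longleftrightarrow>
    (\<forall>X\<subseteq>P. X \<noteq> {} \<longrightarrow> closed_under_blocks B X \<longrightarrow> X = P)"
proof
  assume connected: "config_connected P B"
  show "\<forall>X\<subseteq>P. X \<noteq> {} \<longrightarrow> closed_under_blocks B X \<longrightarrow> X = P"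
  proof (intro allI impI)
    fix X assume X: "X \<subseteq> P" "X \<noteq> {}" "closed_under_blocks B X"
    then have "\<forall>b\<in>B. b \<subseteq> X \<or> b \<subseteq> P - X"
      using assms by (fastforce simp: closed_under_blocks_def)
    then have "P - X = {}"
      using connected X(1,2) unfolding config_connected_def
      by (metis Diff_disjoint Diff_partition)
    with X(1) show "X = P" by blast
  qed
next
  assume closed_eq: "\<forall>X\<subseteq>P. X \<noteq> {} \<longrightarrow> closed_under_blocks B X \<longrightarrow> X = P"
  show "config_connected P B"
    unfolding config_connected_def
  proof (intro notI, elim exE conjE)
    fix X Y
    assume XY: "X \<noteq> {}" "Y \<noteq> {}" "X \<inter> Y = {}" "X \<union> Y = P" "\<forall>b\<in>B. b \<subseteq> X \<or> b \<subseteq> Y"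
    then have "closed_under_blocks B X"
      unfolding closed_under_blocks_def by blast
    with closed_eq XY show False by blast
  qed
qed

lemma config_connected_if_descending:
  fixes P :: "'a :: wellorder set"
  assumes "B \<subseteq> Pow P"
    and descend: "\<And>p. p \<in> P \<Longrightarrow> p \<noteq> p\<^sub>0 \<Longrightarrow> \<exists>b\<in>B. p \<in> b \<and> (\<exists>q\<in>b. q < p)"
  shows "config_connected P B"
  unfolding config_connected_iff[OF assms(1)]
proof (intro allI impI)
  fix X assume "X \<subseteq> P" "X \<noteq> {}" and closed: "closed_under_blocks B X"
  have "p \<in> X \<longleftrightarrow> p\<^sub>0 \<in> X" if "p \<in> P" for p
    using that
  proof (induction p rule: less_induct)
    case (less p)
    show ?case
    proof (cases "p = p\<^sub>0")
      case False
      then obtain b q where b: "b \<in> B" "p \<in> b" "q \<in> b" "q < p"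
        using descend less.prems by blast
      then have "p \<in> X \<longleftrightarrow> q \<in> X"
        using closed unfolding closed_under_blocks_iff by blast
      with b less.IH[of q] show ?thesis
        using assms(1) by blast
    qed simp
  qed
  then show "X = P"
    using \<open>X \<subseteq> P\<close> \<open>X \<noteq> {}\<close> by blast
qed

section \<open>Heavy blocks\<close>

definition bichromatic :: "'a set \<Rightarrow> 'a set \<Rightarrow> bool" where
  "bichromatic Q b \<longleftrightarrow> b \<inter> Q \<noteq> {} \<and> b - Q \<noteq> {}"

definition heavy_blocks :: "'a set set \<Rightarrow> 'a set \<Rightarrow> 'a set set" where
  "heavy_blocks B Q = {b \<in> B. 2 \<le> card (b \<inter> Q)}"

definition forces_heavy :: "'a set set \<Rightarrow> nat \<Rightarrow> bool" where
  "forces_heavy L k \<longleftrightarrow> (\<forall>Q. (\<forall>b\<in>L. bichromatic Q b) \<longrightarrow> k \<le> card (heavy_blocks L Q))"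

lemma blocking_set_iff_bichromatic:
  "blocking_set P B Q \<longleftrightarrow> Q \<subseteq> P \<and> (\<forall>b\<in>B. bichromatic Q b)"
  by (simp add: blocking_set_def bichromatic_def)

lemma card_Int_bichromatic:
  assumes "card b = 3" "bichromatic Q b"
  shows "card (b \<inter> Q) = 1 + of_bool (2 \<le> card (b \<inter> Q))"
proof -
  have "finite b" using assms(1) by (simp add: card_ge_0_finite)
  then have "card (b \<inter> Q) \<noteq> 0" "card (b - Q) \<noteq> 0" "card b = card (b \<inter> Q) + card (b - Q)"
    using assms(2) by (auto simp: bichromatic_def card_Int_Diff)
  with assms(1) show ?thesis by auto
qed

lemma three_times_card_blocking_set:
  assumes config: "sym_config_v3 P B v" and Q: "blocking_set P B Q"
  shows "3 * card Q = v + card (heavy_blocks B Q)"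
proof -
  have fin: "finite B" "finite Q"
    using config Q by (auto simp: sym_config_v3_def blocking_set_def intro: finite_subset)
  have "3 * card Q = (\<Sum>b\<in>B. card (b \<inter> Q))"
    using config Q fin
    by (intro sum_card_Int_eq_mult_card[symmetric]) (auto simp: sym_config_v3_def blocking_set_def)
  also have "\<dots> = (\<Sum>b\<in>B. 1 + of_bool (2 \<le> card (b \<inter> Q)))"
    using config Q
    by (intro sum.cong refl, subst card_Int_bichromatic)
      (auto simp: sym_config_v3_def blocking_set_iff_bichromatic)
  also have "\<dots> = card B + card (heavy_blocks B Q)"
    using fin
    by (simp only: sum.distrib sum_of_bool_eq) (simp add: heavy_blocks_def Collect_conj_eq)
  finally show ?thesis
    using config by (simp add: sym_config_v3_def)
qed

lemma min_blocking_card_if_forces_heavy: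
  assumes config: "sym_config_v3 P B v" and L: "L \<subseteq> B" "forces_heavy L k"
    and Q: "blocking_set P B Q" "3 * card Q < v + k + 3"
  shows "min_blocking_card P B (card Q)"
  unfolding min_blocking_card_def
proof (intro conjI allI impI)
  show "\<exists>Q'. blocking_set P B Q' \<and> card Q' = card Q"
    using Q by blast
next
  fix Q' assume Q': "blocking_set P B Q'"
  have "k \<le> card (heavy_blocks L Q')"
    using L Q' unfolding forces_heavy_def blocking_set_iff_bichromatic by blast
  also have "\<dots> \<le> card (heavy_blocks B Q')"
    using L(1) config by (intro card_mono) (auto simp: heavy_blocks_def sym_config_v3_def)
  finally show "card Q \<le> card Q'"
    using three_times_card_blocking_set[OF config Q'] Q(2) by simp
qed

section \<open>Adding three points\<close>

locale triangle_extension =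
  fixes P :: "'a set" and B :: "'a set set" and v :: nat and S :: "'a set set"
    and u p :: "'a set \<Rightarrow> 'a"
  assumes config: "sym_config_v3 P B v"
    and parallel: "S \<subseteq> B" "card S = 3" "pairwise disjnt S"
    and u_mem: "A \<in> S \<Longrightarrow> u A \<in> A"
    and fresh: "inj_on p S" "p ` S \<inter> P = {}"
begin

definition points :: "'a set" where
  "points = P \<union> p ` S"

definition swapped :: "'a set \<Rightarrow> 'a set" where
  "swapped A = insert (p A) (A - {u A})"

definition apex :: "'a set \<Rightarrow> 'a set" where
  "apex A = insert (u A) (p ` (S - {A}))"

definition blocks :: "'a set set" where
  "blocks = (B - S) \<union> swapped ` S \<union> apex ` S"

lemma blocks_cases [consumes 1, case_names old swapped apex]:
  assumes "e \<in> blocks"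
  obtains "e \<in> B" "e \<notin> S" | A where "A \<in> S" "e = swapped A" | A where "A \<in> S" "e = apex A"
  using assms by (auto simp: blocks_def)

lemma new_mem_blocks: "A \<in> S \<Longrightarrow> swapped A \<in> blocks" "A \<in> S \<Longrightarrow> apex A \<in> blocks"
  by (auto simp: blocks_def)

lemma finite_P: "finite P"
  and card_P: "card P = v"
  and block_subset: "e \<in> B \<Longrightarrow> e \<subseteq> P"
  and card_block: "e \<in> B \<Longrightarrow> card e = 3"
  using config by (auto simp: sym_config_v3_iff)

lemma card_old_Int_old: "e \<in> B \<Longrightarrow> f \<in> B \<Longrightarrow> e \<noteq> f \<Longrightarrow> card (e \<inter> f) \<le> 1"
  using config unfolding sym_config_v3_iff by metis

lemma finite_S: "finite S"
  using parallel(2) by (simp add: card_ge_0_finite)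

lemma fresh_notin_P: "A \<in> S \<Longrightarrow> p A \<notin> P"
  using fresh(2) by blast

lemma S_subset_P: "A \<in> S \<Longrightarrow> A \<subseteq> P"
  using parallel(1) block_subset by blast

lemma fresh_notin_block: "A \<in> S \<Longrightarrow> e \<in> B \<Longrightarrow> p A \<notin> e"
  using fresh_notin_P block_subset by blast

lemma fresh_eq_iff: "A \<in> S \<Longrightarrow> C \<in> S \<Longrightarrow> p A = p C \<longleftrightarrow> A = C"
  using fresh(1) by (simp add: inj_on_eq_iff)

lemma u_mem_P: "A \<in> S \<Longrightarrow> u A \<in> P"
  using u_mem S_subset_P by blast

lemma parallel_eqI: "A \<in> S \<Longrightarrow> C \<in> S \<Longrightarrow> q \<in> A \<Longrightarrow> q \<in> C \<Longrightarrow> A = C"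
  using parallel(3) by (auto simp: pairwise_def disjnt_iff)

lemma fresh_mem_iff:
  assumes "A \<in> S" "C \<in> S"
  shows "p A \<in> swapped C \<longleftrightarrow> A = C" "p A \<in> apex C \<longleftrightarrow> A \<noteq> C"
proof -
  have "p A \<notin> C" "p A \<noteq> u C"
    using assms fresh_notin_P S_subset_P u_mem_P by force+
  with assms fresh_eq_iff show "p A \<in> swapped C \<longleftrightarrow> A = C" "p A \<in> apex C \<longleftrightarrow> A \<noteq> C"
    by (auto simp: swapped_def apex_def)
qed

lemma u_mem_iff:
  assumes "A \<in> S" "C \<in> S"
  shows "u A \<notin> swapped C" "u A \<in> apex C \<longleftrightarrow> A = C"
proof -
  have "u A \<in> C \<longleftrightarrow> A = C" "u A \<noteq> p C'" if "C' \<in> S" for C'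
    using assms that u_mem parallel_eqI u_mem_P fresh_notin_P by metis+
  with assms u_mem show "u A \<notin> swapped C" "u A \<in> apex C \<longleftrightarrow> A = C"
    by (auto simp: swapped_def apex_def)
qed

lemma card_swapped: "A \<in> S \<Longrightarrow> card (swapped A) = 3"
  using parallel(1) card_block[of A] u_mem[of A] fresh_notin_block[of A A]
  by (auto simp: swapped_def card_insert_if card_ge_0_finite)

lemma card_apex:
  assumes A: "A \<in> S"
  shows "card (apex A) = 3"
proof -
  have "card (p ` (S - {A})) = 2"
    using A parallel(2) by (subst card_image[OF inj_on_subset[OF fresh(1)]]) auto
  moreover have "u A \<notin> p ` (S - {A})"
    using u_mem_P[OF A] fresh(2) by blast
  ultimately show ?thesis
    using finite_S by (simp add: apex_def)
qed

lemma ex_third: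
  obtains D where "D \<in> S" "D \<noteq> A" "D \<noteq> C"
proof -
  have "\<not> S \<subseteq> {A, C}"
    using parallel(2) card_mono[of "{A, C}" S] by (auto simp: card_insert_if split: if_splits)
  with that show thesis by blast
qed

lemma inj_on_swapped: "inj_on swapped S"
  by (intro inj_onI) (metis fresh_mem_iff(1))

lemma inj_on_apex: "inj_on apex S"
  by (intro inj_onI) (metis u_mem_iff(2))

lemma blocks_subset: "blocks \<subseteq> Pow points"
  using block_subset S_subset_P u_mem_P
  by (fastforce simp: blocks_def points_def swapped_def apex_def)

lemma new_notin_B:
  assumes "A \<in> S"
  shows "swapped A \<notin> B" "apex A \<notin> B"
proof -
  obtain C where "C \<in> S" "C \<noteq> A"
    by (rule ex_third)
  then show "swapped A \<notin> B" "apex A \<notin> B"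
    using assms fresh_notin_block fresh_mem_iff by blast+
qed

lemma bij_betw_blocks_through_old:
  assumes "q \<in> P"
  shows "bij_betw (\<lambda>e. if e \<in> S then if q = u e then apex e else swapped e else e)
    {e \<in> B. q \<in> e} {e \<in> blocks. q \<in> e}"
    (is "bij_betw ?f _ _")
proof (rule bij_betwI')
  fix e f assume e: "e \<in> {e \<in> B. q \<in> e}" and f: "f \<in> {e \<in> B. q \<in> e}"
  have new: "?f g \<notin> B" if "g \<in> S" for g
    using that new_notin_B by simp
  show "?f e = ?f f \<longleftrightarrow> e = f"
    using e f new[of e] new[of f] parallel_eqI[of e f q] by auto
next
  fix e assume "e \<in> {e \<in> B. q \<in> e}"
  then show "?f e \<in> {e \<in> blocks. q \<in> e}"
    by (auto simp: blocks_def apex_def swapped_def)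
next
  fix e assume "e \<in> {e \<in> blocks. q \<in> e}"
  then have "e \<in> blocks" "q \<in> e" by auto
  then show "\<exists>f\<in>{e \<in> B. q \<in> e}. e = ?f f"
  proof (cases rule: blocks_cases)
    case old
    with \<open>q \<in> e\<close> show ?thesis by auto
  next
    case (swapped A)
    with \<open>q \<in> e\<close> assms fresh_notin_P have "q \<in> A" "q \<noteq> u A" by (auto simp: swapped_def)
    with swapped parallel(1) show ?thesis by (intro bexI[of _ A]) auto
  next
    case (apex A)
    with \<open>q \<in> e\<close> assms fresh_notin_P have "q = u A" by (auto simp: apex_def)
    with apex parallel(1) u_mem show ?thesis by (intro bexI[of _ A]) auto
  qed
qed

lemma degree_at_fresh:
  assumes "A \<in> S"
  shows "card {e \<in> blocks. p A \<in> e} = 3"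
proof -
  have "{e \<in> blocks. p A \<in> e} = insert (swapped A) (apex ` (S - {A}))"
    using assms fresh_notin_block fresh_mem_iff by (auto simp: blocks_def)
  moreover have "card (apex ` (S - {A})) = 2"
    using assms parallel(2) by (subst card_image[OF inj_on_subset[OF inj_on_apex]]) auto
  moreover have "swapped A \<notin> apex ` (S - {A})"
    using assms u_mem_iff by blast
  ultimately show ?thesis
    using finite_S by simp
qed

lemma degree_blocks:
  assumes "q \<in> points"
  shows "card {e \<in> blocks. q \<in> e} = 3"
proof (cases "q \<in> P")
  case True
  then have "card {e \<in> B. q \<in> e} = 3"
    using config by (simp add: sym_config_v3_iff)
  with bij_betw_same_card[OF bij_betw_blocks_through_old[OF True]] show ?thesis by simp
next
  case False
  then show ?thesis
    using assms degree_at_fresh by (auto simp: points_def)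
qed

lemma swapped_Int_swapped:
  assumes "A \<in> S" "C \<in> S" "A \<noteq> C"
  shows "swapped A \<inter> swapped C = {}"
  using assms parallel_eqI[OF assms(1,2)] fresh_mem_iff(1)[of A C] fresh_mem_iff(1)[of C A]
  by (auto simp: swapped_def)

lemma swapped_Int_apex:
  assumes "A \<in> S" "C \<in> S"
  shows "swapped A \<inter> apex C \<subseteq> {p A}"
  using assms u_mem_iff(1)[of C A] fresh_mem_iff(1)[of _ A] by (auto simp: apex_def)

lemma apex_Int_apex:
  assumes "A \<in> S" "C \<in> S" "A \<noteq> C"
  obtains D where "apex A \<inter> apex C \<subseteq> {p D}"
proof -
  have "card (S - {A, C}) = 1"
    using assms parallel(2) by simp
  then obtain D where D: "S - {A, C} = {D}"
    by (rule card_1_singletonE)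
  have "apex A \<inter> apex C \<subseteq> {p D}"
  proof
    fix q assume q: "q \<in> apex A \<inter> apex C"
    then have "q \<noteq> u A"
      using assms u_mem_iff(2)[of A C] by blast
    with q obtain E where E: "E \<in> S" "q = p E"
      by (auto simp: apex_def)
    then have "p E \<in> apex A" "p E \<in> apex C"
      using q by simp_all
    then have "E \<in> S - {A, C}"
      using assms E(1) fresh_mem_iff(2) by simp
    with D E(2) show "q \<in> {p D}" by simp
  qed
  then show thesis by (rule that)
qed

lemma card_old_Int_swapped:
  assumes "e \<in> B" "e \<notin> S" "A \<in> S"
  shows "card (e \<inter> swapped A) \<le> 1"
proof -
  have "e \<inter> swapped A \<subseteq> e \<inter> A"
    using assms fresh_notin_block by (auto simp: swapped_def)
  then have "card (e \<inter> swapped A) \<le> card (e \<inter> A)"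
    using assms(1) card_block[of e] by (intro card_mono) (auto simp: card_ge_0_finite)
  also have "\<dots> \<le> 1"
    using assms parallel(1) by (intro card_old_Int_old) auto
  finally show ?thesis .
qed

lemma old_Int_apex:
  assumes "e \<in> B" "A \<in> S"
  shows "e \<inter> apex A \<subseteq> {u A}"
  using assms fresh_notin_block by (auto simp: apex_def)

lemma card_blocks_Int_le_1:
  assumes "e \<in> blocks" "f \<in> blocks" "e \<noteq> f"
  shows "card (e \<inter> f) \<le> 1"
proof -
  have singleton: "card X \<le> 1" if "X \<subseteq> {q}" for X and q :: 'a
    using card_mono[OF _ that] by simp
  have swapped_swapped: "card (swapped A \<inter> swapped C) \<le> 1" if "A \<in> S" "C \<in> S" "A \<noteq> C" for A C
    using swapped_Int_swapped[OF that] by simp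
  have apex_apex: "card (apex A \<inter> apex C) \<le> 1" if "A \<in> S" "C \<in> S" "A \<noteq> C" for A C
    using apex_Int_apex[OF that] singleton by metis
  have old: "card (e \<inter> f) \<le> 1" if "e \<in> B" "e \<notin> S" "f \<in> blocks" "e \<noteq> f" for e f
    using that(3)
    by (cases rule: blocks_cases)
      (use that card_old_Int_old card_old_Int_swapped old_Int_apex[THEN singleton] in auto)
  have swapped: "card (swapped A \<inter> f) \<le> 1" if "A \<in> S" "f \<in> blocks" "swapped A \<noteq> f" for A f
    using that(2)
    by (cases rule: blocks_cases)
      (metis that Int_commute card_old_Int_swapped swapped_swapped
        swapped_Int_apex[THEN singleton])+
  have apex: "card (apex A \<inter> f) \<le> 1" if "A \<in> S" "f \<in> blocks" "apex A \<noteq> f" for A f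
    using that(2)
    by (cases rule: blocks_cases)
      (metis that Int_commute old_Int_apex[THEN singleton] swapped_Int_apex[THEN singleton]
        apex_apex)+
  show ?thesis
    using assms(1) by (cases rule: blocks_cases) (use assms old swapped apex in auto)
qed

lemma card_points: "card points = v + 3"
proof -
  have "card (p ` S) = 3"
    using fresh(1) parallel(2) by (simp add: card_image)
  then show ?thesis
    using card_P fresh(2) finite_P finite_S
    by (simp add: points_def card_Un_disjoint Int_commute)
qed

theorem sym_config_extension: "sym_config_v3 points blocks (v + 3)"
proof -
  have "card e = 3" if "e \<in> blocks" for e
    using that by (cases rule: blocks_cases) (auto simp: card_block card_swapped card_apex)
  moreover have "finite points"
    using finite_P finite_S by (simp add: points_def)
  ultimately show ?thesis
    using card_points blocks_subset degree_blocks card_blocks_Int_le_1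
    unfolding sym_config_v3_iff by blast
qed

lemma closed_fresh_iff:
  assumes closed: "closed_under_blocks blocks X" and AC: "A \<in> S" "C \<in> S"
  shows "p A \<in> X \<longleftrightarrow> p C \<in> X"
proof -
  obtain D where "D \<in> S" "D \<noteq> A" "D \<noteq> C" by (rule ex_third)
  then have "apex D \<in> blocks" "p A \<in> apex D" "p C \<in> apex D"
    using AC by (simp_all add: new_mem_blocks fresh_mem_iff)
  with closed show ?thesis
    unfolding closed_under_blocks_iff by blast
qed

lemma closed_old_iff_fresh:
  assumes closed: "closed_under_blocks blocks X" and A: "A \<in> S" and q: "q \<in> A"
  shows "q \<in> X \<longleftrightarrow> p A \<in> X"
proof (cases "q = u A")
  case True
  obtain C where C: "C \<in> S" "C \<noteq> A" by (rule ex_third)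
  with A True have "apex A \<in> blocks" "q \<in> apex A" "p C \<in> apex A"
    by (simp_all add: new_mem_blocks fresh_mem_iff u_mem_iff)
  then have "q \<in> X \<longleftrightarrow> p C \<in> X"
    using closed unfolding closed_under_blocks_iff by blast
  with closed_fresh_iff[OF closed A C(1)] show ?thesis by simp
next
  case False
  with q have "q \<in> swapped A" "p A \<in> swapped A"
    by (simp_all add: swapped_def)
  with closed new_mem_blocks(1)[OF A] show ?thesis
    unfolding closed_under_blocks_iff by blast
qed

theorem connected_extension:
  assumes "config_connected P B"
  shows "config_connected points blocks"
  unfolding config_connected_iff[OF blocks_subset]
proof (intro allI impI)
  fix X assume X: "X \<subseteq> points" "X \<noteq> {}" and closed: "closed_under_blocks blocks X"
  have "q \<in> X \<longleftrightarrow> r \<in> X" if "e \<in> B" "q \<in> e" "r \<in> e" for e q r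
  proof (cases "e \<in> S")
    case True
    with that closed_old_iff_fresh[OF closed] show ?thesis by blast
  next
    case False
    with that have "e \<in> blocks" by (simp add: blocks_def)
    with that closed show ?thesis
      unfolding closed_under_blocks_iff by blast
  qed
  then have "closed_under_blocks B (X \<inter> P)"
    using block_subset unfolding closed_under_blocks_iff by blast
  moreover have u_iff_fresh: "u A \<in> X \<inter> P \<longleftrightarrow> p A \<in> X" if "A \<in> S" for A
    using that closed_old_iff_fresh[OF closed] u_mem u_mem_P by simp
  moreover have "X \<inter> P \<noteq> {}"
    using X u_iff_fresh unfolding points_def by fastforce
  moreover have "\<forall>Y\<subseteq>P. Y \<noteq> {} \<longrightarrow> closed_under_blocks B Y \<longrightarrow> Y = P"
    using assms block_subset config_connected_iff[of B P] by blast
  ultimately have "X \<inter> P = P"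
    by (metis Int_lower2)
  with X(1) show "X = points"
    using u_iff_fresh u_mem_P unfolding points_def by fastforce
qed

theorem blocking_set_extension:
  assumes Q: "blocking_set P B Q" and A: "A \<in> S"
    and u: "\<And>C. C \<in> S \<Longrightarrow> u C \<in> Q \<longleftrightarrow> C = A"
  shows "blocking_set points blocks (insert (p A) Q)"
proof -
  have QP: "Q \<subseteq> P" and bichromatic: "\<And>e. e \<in> B \<Longrightarrow> bichromatic Q e"
    using Q by (auto simp: blocking_set_iff_bichromatic)
  have p_mem: "p C \<in> insert (p A) Q \<longleftrightarrow> C = A" if "C \<in> S" for C
    using that A QP fresh_notin_P fresh_eq_iff by auto
  have u_mem_insert: "u C \<in> insert (p A) Q \<longleftrightarrow> C = A" if "C \<in> S" for C
    using u[OF that] u_mem_P[OF that] fresh_notin_P[OF A] by auto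
  have "bichromatic (insert (p A) Q) e" if "e \<in> blocks" for e
    using that
  proof (cases rule: blocks_cases)
    case old
    with bichromatic A fresh_notin_block show ?thesis by (auto simp: bichromatic_def)
  next
    case (swapped C)
    obtain q where "q \<in> C" "q \<noteq> u C" "q \<in> Q \<longleftrightarrow> C \<noteq> A"
      using bichromatic[of C] u[of C] swapped(1) parallel(1) by (auto simp: bichromatic_def)
    with swapped p_mem[of C] fresh_notin_block[of A C] A parallel(1)
    show ?thesis by (auto simp: bichromatic_def swapped_def)
  next
    case (apex C)
    obtain D where "D \<in> S" "D \<noteq> C" "C = A \<longleftrightarrow> D \<noteq> A"
      using ex_third[of C A] A by metis
    with apex p_mem[of D] u_mem_insert[of C] show ?thesis
      by (auto simp: bichromatic_def apex_def)
  qed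
  then show ?thesis
    using A QP by (auto simp: blocking_set_iff_bichromatic points_def)
qed

lemma card_insert_fresh:
  assumes "blocking_set P B Q" "A \<in> S"
  shows "card (insert (p A) Q) = card Q + 1"
proof -
  have "Q \<subseteq> P" using assms(1) by (simp add: blocking_set_def)
  then show ?thesis
    using assms(2) fresh_notin_P finite_P by (auto simp: finite_subset card_insert_if)
qed

lemma parallel_swapped:
  "swapped ` S \<subseteq> blocks" "card (swapped ` S) = 3" "pairwise disjnt (swapped ` S)"
proof -
  show "swapped ` S \<subseteq> blocks"
    by (auto simp: blocks_def)
  show "card (swapped ` S) = 3"
    using inj_on_swapped parallel(2) by (simp add: card_image)
  show "pairwise disjnt (swapped ` S)"
    using swapped_Int_swapped by (auto simp: pairwise_def disjnt_def)
qed

end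

section \<open>Iterating the extension\<close>

definition extendable :: "'a set set \<Rightarrow> nat \<Rightarrow> nat \<Rightarrow> bool" where
  "extendable L v m \<longleftrightarrow> (\<exists>P B Q S. sym_config_v3 P B v \<and> config_connected P B \<and>
     blocking_set P B Q \<and> card Q = m \<and> L \<subseteq> B - S \<and> S \<subseteq> B \<and> card S = 3 \<and> pairwise disjnt S)"

lemma ex_inj_on_avoiding:
  fixes P :: "'a set"
  assumes "infinite (UNIV :: 'a set)" "finite P" "finite S"
  obtains p :: "'b \<Rightarrow> 'a" where "inj_on p S" "p ` S \<inter> P = {}"
proof -
  have "infinite (- P)"
    using assms(1,2) by (simp add: Compl_eq_Diff_UNIV)
  then obtain T where T: "T \<subseteq> - P" "finite T" "card T = card S"
    using infinite_arbitrarily_large by metis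
  then obtain p where "bij_betw p S T"
    using finite_same_card_bij[OF assms(3)] by metis
  with T(1) that show thesis
    by (metis bij_betw_def disjoint_eq_subset_Compl)
qed

lemma extendable_add_three:
  fixes L :: "'a set set"
  assumes "extendable L v m" and infinite: "infinite (UNIV :: 'a set)"
  shows "extendable L (v + 3) (m + 1)"
proof -
  obtain P B Q S where config: "sym_config_v3 P B v" and connected: "config_connected P B"
    and Q: "blocking_set P B Q" "card Q = m" and L: "L \<subseteq> B - S"
    and S: "S \<subseteq> B" "card S = 3" "pairwise disjnt S"
    using assms(1) unfolding extendable_def by blast
  obtain A where A: "A \<in> S"
    using S(2) by fastforce
  have "\<forall>C\<in>S. \<exists>q\<in>C. q \<in> Q \<longleftrightarrow> C = A"
    using S(1) Q(1) by (fastforce simp: blocking_set_def)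
  then obtain u where u: "C \<in> S \<Longrightarrow> u C \<in> C" "C \<in> S \<Longrightarrow> u C \<in> Q \<longleftrightarrow> C = A" for C
    by metis
  obtain p :: "'a set \<Rightarrow> 'a" where p: "inj_on p S" "p ` S \<inter> P = {}"
    using ex_inj_on_avoiding[OF infinite] config S(2)
    by (metis card.infinite sym_config_v3_iff zero_neq_numeral)
  interpret triangle_extension P B v S u p
    by unfold_locales (use config S u p in auto)
  have "L \<subseteq> blocks - swapped ` S"
    using L new_notin_B(1) by (auto simp: blocks_def)
  moreover have "blocking_set points blocks (insert (p A) Q)" "card (insert (p A) Q) = m + 1"
    using Q A u blocking_set_extension card_insert_fresh by blast+
  ultimately show ?thesis
    unfolding extendable_def
    using sym_config_extension connected_extension[OF connected] parallel_swapped by blast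
qed

lemma extendable_add:
  fixes L :: "'a set set"
  assumes "extendable L v m" "infinite (UNIV :: 'a set)"
  shows "extendable L (v + 3 * n) (m + n)"
proof (induction n)
  case (Suc n)
  then show ?case
    using extendable_add_three[OF Suc assms(2)] by (simp add: algebra_simps)
qed (use assms in simp)

definition attains_min_blocking :: "nat \<Rightarrow> nat \<Rightarrow> bool" where
  "attains_min_blocking v m \<longleftrightarrow> (\<exists>(P :: nat set) B. sym_config_v3 P B v \<and> config_connected P B \<and>
     min_blocking_card P B m)"

lemma extendable_attains_min_blocking:
  fixes L :: "nat set set"
  assumes "extendable L v m" "forces_heavy L k" "3 * m < v + k + 3"
  shows "attains_min_blocking (v + 3 * n) (m + n)"
proof -
  have "extendable L (v + 3 * n) (m + n)"
    using assms(1) by (rule extendable_add) simp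
  then obtain P B Q where "sym_config_v3 P B (v + 3 * n)" "config_connected P B"
    "blocking_set P B Q" "card Q = m + n" "L \<subseteq> B"
    unfolding extendable_def by blast
  moreover have "3 * (m + n) < v + 3 * n + k + 3"
    using assms(3) by simp
  ultimately show ?thesis
    unfolding attains_min_blocking_def
    using assms(2) min_blocking_card_if_forces_heavy by metis
qed

section \<open>Exhaustive search\<close>

text \<open>The blocks of the list are decided one after the other: \<open>R\<close> and \<open>W\<close> are the points already
  known to lie inside and outside \<open>Q\<close>, and \<open>A\<close> runs through the possible values of \<open>b \<inter> Q\<close>.\<close>

fun search_forces_heavy :: "'a set \<Rightarrow> 'a set \<Rightarrow> 'a set list \<Rightarrow> nat \<Rightarrow> bool" where
  "search_forces_heavy R W bs 0 \<longleftrightarrow> True"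
| "search_forces_heavy R W [] (Suc k) \<longleftrightarrow> False"
| "search_forces_heavy R W (b # bs) (Suc k) \<longleftrightarrow>
     (\<forall>A\<in>(\<union>) (b \<inter> R) ` Pow (b - R - W) - {{}, b}.
        search_forces_heavy (R \<union> A) (W \<union> (b - A)) bs (if 2 \<le> card A then k else Suc k))"

lemma search_forces_heavy_sound:
  assumes "search_forces_heavy R W bs k" "distinct bs" "R \<subseteq> Q" "W \<inter> Q = {}"
    and "\<forall>b\<in>set bs. bichromatic Q b"
  shows "k \<le> card (heavy_blocks (set bs) Q)"
  using assms
proof (induction bs arbitrary: R W k)
  case Nil
  then show ?case by (cases k) simp_all
next
  case (Cons b bs)
  show ?case
  proof (cases k)
    case (Suc j)
    define A where "A = b \<inter> Q"
    have "A = b \<inter> R \<union> (A - R)" "A - R \<in> Pow (b - R - W)" "A \<notin> {{}, b}"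
      using Cons.prems by (auto simp: A_def bichromatic_def)
    then have "A \<in> (\<union>) (b \<inter> R) ` Pow (b - R - W) - {{}, b}"
      by blast
    then have "search_forces_heavy (R \<union> A) (W \<union> (b - A)) bs (if 2 \<le> card A then j else Suc j)"
      using Cons.prems(1) unfolding Suc search_forces_heavy.simps by blast
    then have "(if 2 \<le> card A then j else Suc j) \<le> card (heavy_blocks (set bs) Q)"
      by (rule Cons.IH) (use Cons.prems in \<open>auto simp: A_def\<close>)
    moreover have "heavy_blocks (set (b # bs)) Q =
        (if 2 \<le> card A then insert b (heavy_blocks (set bs) Q) else heavy_blocks (set bs) Q)"
      by (auto simp: heavy_blocks_def A_def)
    moreover have "b \<notin> heavy_blocks (set bs) Q" "finite (heavy_blocks (set bs) Q)"
      using Cons.prems(2) by (auto simp: heavy_blocks_def)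
    ultimately show ?thesis
      by (simp add: Suc split: if_splits)
  qed simp
qed

definition certified_config ::
    "nat \<Rightarrow> nat \<Rightarrow> nat \<Rightarrow> nat set list \<Rightarrow> nat set list \<Rightarrow> nat set \<Rightarrow> bool" where
  "certified_config v m k S L Q \<longleftrightarrow> (let B = set (S @ L) in
     (\<forall>b\<in>B. b \<subseteq> {..<v} \<and> card b = 3) \<and> (\<forall>p\<in>{..<v}. card {b \<in> B. p \<in> b} = 3) \<and>
     (\<forall>b\<in>B. \<forall>b'\<in>B. b \<noteq> b' \<longrightarrow> card (b \<inter> b') \<le> 1) \<and>
     (\<forall>p\<in>{1..<v}. \<exists>b\<in>B. p \<in> b \<and> (\<exists>q\<in>b. q < p)) \<and>
     blocking_set {..<v} B Q \<and> card Q = m \<and> 3 * m < v + k + 3 \<and>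
     distinct (S @ L) \<and> search_forces_heavy {} {} L k)"

lemma
  assumes "certified_config v m k S L Q"
  defines "B \<equiv> set (S @ L)"
  shows certified_config_sym_config: "sym_config_v3 {..<v} B v"
    and certified_config_connected: "config_connected {..<v} B"
    and certified_config_blocking_set: "blocking_set {..<v} B Q"
    and certified_config_forces_heavy: "forces_heavy (set L) k"
proof -
  have sub: "B \<subseteq> Pow {..<v}"
    and descend: "\<forall>p\<in>{1..<v}. \<exists>b\<in>B. p \<in> b \<and> (\<exists>q\<in>b. q < p)"
    and search: "distinct L" "search_forces_heavy {} {} L k"
    using assms by (auto simp: certified_config_def Let_def)
  show "sym_config_v3 {..<v} B v" "blocking_set {..<v} B Q"
    using assms sub by (simp_all add: certified_config_def sym_config_v3_iff Let_def)
  show "config_connected {..<v} B"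
    using sub by (rule config_connected_if_descending[of _ _ 0]) (use descend in auto)
  show "forces_heavy (set L) k"
    unfolding forces_heavy_def
    using search_forces_heavy_sound[OF search(2,1)] by auto
qed

lemmas certified_config_props =
  certified_config_sym_config certified_config_connected certified_config_blocking_set
  certified_config_forces_heavy

lemma certified_config_attains_min_blocking:
  assumes certified: "certified_config v m k [] L Q"
  shows "attains_min_blocking v m"
proof -
  have "card Q = m" "3 * m < v + k + 3"
    using certified by (simp_all add: certified_config_def Let_def)
  moreover note certified_config_props[OF certified, unfolded append_Nil]
  ultimately show ?thesis
    unfolding attains_min_blocking_def using min_blocking_card_if_forces_heavy by blast
qed

lemma certified_config_attains_min_blocking_add:
  assumes certified: "certified_config v m k S L Q" and S: "length S = 3" "pairwise disjnt (set S)"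
  shows "attains_min_blocking (v + 3 * n) (m + n)"
proof (rule extendable_attains_min_blocking)
  have "distinct (S @ L)" "card Q = m" "3 * m < v + k + 3"
    using certified by (simp_all add: certified_config_def Let_def)
  moreover from this have "set L \<subseteq> set (S @ L) - set S" "card (set S) = 3"
    using S(1) by (auto simp: distinct_card)
  ultimately show "extendable (set L) v m" "3 * m < v + k + 3"
    unfolding extendable_def
    using certified_config_props[OF certified] S(2) by (metis set_append sup_ge1)+
qed (rule certified_config_forces_heavy[OF certified])

section \<open>Small and base configurations\<close>

lemma attains_8_4: "attains_min_blocking 8 4"
  by (rule certified_config_attains_min_blocking[of _ _ 2
    "[{0, 1, 2}, {0, 4, 6}, {1, 3, 4}, {0, 3, 7}, {2, 6, 7}, {3, 5, 6}, {1, 5, 7}, {2, 4, 5}]"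
    "{1, 4, 6, 7}"]) code_simp

lemma attains_9_4: "attains_min_blocking 9 4"
  by (rule certified_config_attains_min_blocking[of _ _ 1
    "[{0, 1, 2}, {1, 3, 4}, {0, 4, 6}, {1, 6, 8}, {2, 6, 7}, {3, 7, 8}, {2, 5, 8}, {4, 5, 7},
     {0, 3, 5}]"
    "{2, 3, 4, 6}"]) code_simp

lemma attains_10_5: "attains_min_blocking 10 5"
  by (rule certified_config_attains_min_blocking[of _ _ 3
    "[{1, 3, 5}, {1, 7, 8}, {5, 7, 9}, {3, 8, 9}, {0, 6, 7}, {2, 5, 6}, {0, 1, 2}, {4, 6, 9},
     {2, 3, 4}, {0, 4, 8}]"
    "{2, 3, 6, 7, 8}"]) code_simp

lemma attains_11_5: "attains_min_blocking 11 5"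
  by (rule certified_config_attains_min_blocking[of _ _ 2
    "[{0, 1, 2}, {0, 3, 5}, {2, 4, 5}, {1, 3, 4}, {3, 7, 9}, {5, 7, 8}, {0, 6, 7}, {6, 8, 9},
     {4, 8, 10}, {1, 9, 10}, {2, 6, 10}]"
    "{1, 5, 6, 7, 10}"]) code_simp

lemma attains_12_6: "attains_min_blocking 12 6"
  by (rule certified_config_attains_min_blocking[of _ _ 4
    "[{0, 1, 2}, {1, 3, 4}, {2, 4, 5}, {1, 5, 10}, {2, 3, 6}, {4, 6, 7}, {0, 5, 11}, {3, 7, 8},
     {8, 10, 11}, {0, 9, 10}, {7, 9, 11}, {6, 8, 9}]"
    "{0, 1, 5, 6, 7, 8}"]) code_simp

lemma attains_12_5_add: "attains_min_blocking (12 + 3 * n) (5 + n)"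
  by (rule certified_config_attains_min_blocking_add[of _ _ 1
    "[{1, 6, 8}, {3, 9, 11}, {4, 5, 10}]"
    "[{0, 1, 2}, {1, 3, 5}, {0, 3, 4}, {2, 4, 6}, {5, 6, 7}, {7, 10, 11}, {0, 9, 10}, {7, 8, 9},
     {2, 8, 11}]"
    "{2, 3, 7, 8, 10}"])
    (code_simp, auto simp: pairwise_insert disjnt_iff)

lemma attains_13_6: "attains_min_blocking 13 6"
  by (rule certified_config_attains_min_blocking[of _ _ 3
    "[{0, 3, 6}, {1, 3, 4}, {0, 1, 2}, {4, 6, 8}, {2, 3, 5}, {4, 5, 7}, {6, 7, 9}, {0, 9, 10},
     {7, 8, 11}, {1, 10, 11}, {2, 11, 12}, {5, 9, 12}, {8, 10, 12}]"
    "{1, 2, 5, 6, 7, 10}"]) code_simp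

lemma attains_14_6_add: "attains_min_blocking (14 + 3 * n) (6 + n)"
  by (rule certified_config_attains_min_blocking_add[of _ _ 2
    "[{0, 8, 12}, {2, 9, 10}, {6, 7, 13}]"
    "[{0, 1, 2}, {1, 5, 6}, {2, 3, 6}, {1, 3, 4}, {0, 4, 5}, {3, 5, 7}, {4, 8, 9}, {7, 10, 11},
     {9, 11, 12}, {10, 12, 13}, {8, 11, 13}]"
    "{0, 3, 4, 6, 10, 11}"])
    (code_simp, auto simp: pairwise_insert disjnt_iff)

lemma attains_15_7: "attains_min_blocking 15 7"
  by (rule certified_config_attains_min_blocking[of _ _ 4
    "[{0, 1, 2}, {0, 4, 5}, {2, 5, 6}, {2, 3, 4}, {1, 3, 6}, {0, 3, 7}, {4, 7, 9}, {1, 7, 8},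
     {8, 9, 10}, {10, 11, 12}, {5, 12, 13}, {6, 11, 13}, {9, 11, 14}, {10, 13, 14}, {8, 12, 14}]"
    "{0, 2, 3, 8, 9, 11, 13}"]) code_simp

lemma attains_16_8: "attains_min_blocking 16 8"
  by (rule certified_config_attains_min_blocking[of _ _ 6
    "[{2, 3, 5}, {1, 3, 4}, {0, 1, 2}, {4, 6, 8}, {0, 6, 7}, {5, 7, 8}, {1, 6, 11}, {3, 8, 9},
     {4, 9, 15}, {0, 11, 13}, {2, 7, 10}, {5, 10, 12}, {12, 13, 15}, {10, 14, 15}, {9, 13, 14},
     {11, 12, 14}]"
    "{0, 2, 4, 5, 6, 9, 12, 14}"]) code_simp

lemma attains_16_7_add: "attains_min_blocking (16 + 3 * n) (7 + n)"
  by (rule certified_config_attains_min_blocking_add[of _ _ 3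
    "[{6, 9, 14}, {7, 11, 15}, {8, 10, 13}]"
    "[{0, 1, 2}, {2, 4, 6}, {0, 3, 4}, {3, 5, 6}, {1, 4, 5}, {2, 3, 7}, {0, 5, 8}, {1, 7, 8},
     {13, 14, 15}, {10, 12, 15}, {9, 12, 13}, {9, 10, 11}, {11, 12, 14}]"
    "{2, 4, 5, 8, 9, 12, 15}"])
    (code_simp, auto simp: pairwise_insert disjnt_iff)

lemma attains_17_8: "attains_min_blocking 17 8"
  by (rule certified_config_attains_min_blocking[of _ _ 5
    "[{0, 1, 2}, {2, 3, 4}, {0, 3, 6}, {1, 3, 5}, {4, 5, 6}, {0, 5, 8}, {1, 8, 9}, {2, 6, 7},
     {4, 7, 10}, {9, 10, 11}, {8, 14, 16}, {9, 13, 14}, {11, 14, 15}, {13, 15, 16},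
     {11, 12, 13}, {7, 12, 16}, {10, 12, 15}]"
    "{2, 3, 5, 7, 8, 10, 11, 13}"]) code_simp

lemma attains_18_8_add: "attains_min_blocking (18 + 3 * n) (8 + n)"
  by (rule certified_config_attains_min_blocking_add[of _ _ 4
    "[{8, 12, 14}, {9, 13, 17}, {10, 11, 16}]"
    "[{0, 1, 2}, {0, 3, 5}, {2, 3, 6}, {1, 3, 4}, {4, 5, 6}, {2, 5, 7}, {6, 7, 8}, {0, 7, 9},
     {1, 9, 10}, {4, 8, 10}, {13, 14, 15}, {14, 16, 17}, {11, 15, 17}, {11, 12, 13},
     {12, 15, 16}]"
    "{2, 3, 4, 7, 10, 12, 15, 17}"])
    (code_simp, auto simp: pairwise_insert disjnt_iff)

lemma attains_19_9: "attains_min_blocking 19 9"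
  by (rule certified_config_attains_min_blocking[of _ _ 6
    "[{2, 4, 7}, {0, 1, 2}, {1, 4, 5}, {2, 5, 8}, {0, 5, 6}, {0, 3, 4}, {7, 8, 10}, {3, 6, 10},
     {3, 7, 9}, {6, 8, 9}, {9, 10, 11}, {11, 14, 15}, {11, 12, 13}, {13, 14, 16}, {1, 16, 17},
     {12, 15, 17}, {15, 16, 18}, {12, 14, 18}, {13, 17, 18}]"
    "{0, 1, 3, 7, 8, 11, 14, 17, 18}"]) code_simp

lemma attains_20_9: "attains_min_blocking 20 9"
  by (rule certified_config_attains_min_blocking[of _ _ 5
    "[{2, 5, 6}, {2, 3, 4}, {1, 4, 5}, {0, 1, 2}, {1, 3, 9}, {0, 3, 10}, {4, 6, 7}, {5, 7, 8},
     {6, 8, 11}, {8, 10, 12}, {0, 12, 13}, {10, 13, 14}, {12, 14, 15}, {9, 15, 16},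
     {7, 16, 18}, {14, 18, 19}, {11, 15, 19}, {16, 17, 19}, {13, 17, 18}, {9, 11, 17}]"
    "{0, 2, 4, 8, 9, 10, 15, 18, 19}"]) code_simp

lemma attains_22_10: "attains_min_blocking 22 10"
  by (rule certified_config_attains_min_blocking[of _ _ 6
    "[{0, 1, 2}, {0, 3, 4}, {1, 3, 5}, {2, 4, 5}, {0, 5, 6}, {2, 3, 6}, {1, 6, 7}, {4, 8, 14},
     {7, 8, 9}, {7, 11, 13}, {9, 10, 11}, {8, 10, 12}, {9, 12, 13}, {12, 14, 15}, {13, 15, 16},
     {16, 19, 21}, {15, 18, 21}, {16, 18, 20}, {10, 19, 20}, {17, 20, 21}, {11, 17, 19},
     {14, 17, 18}]"
    "{0, 3, 5, 7, 10, 13, 14, 18, 19, 21}"]) code_simp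

lemma attains_23_10_add: "attains_min_blocking (23 + 3 * n) (10 + n)"
  by (rule certified_config_attains_min_blocking_add[of _ _ 5
    "[{8, 17, 21}, {9, 16, 22}, {15, 18, 20}]"
    "[{0, 4, 5}, {0, 1, 2}, {2, 3, 4}, {1, 3, 5}, {1, 4, 6}, {0, 3, 6}, {2, 6, 7}, {5, 8, 9},
     {7, 9, 10}, {7, 12, 13}, {10, 13, 14}, {8, 11, 14}, {10, 11, 12}, {11, 13, 15},
     {12, 14, 15}, {16, 17, 18}, {18, 19, 21}, {16, 19, 20}, {20, 21, 22}, {17, 19, 22}]"
    "{0, 1, 4, 7, 8, 10, 15, 16, 21, 22}"])
    (code_simp, auto simp: pairwise_insert disjnt_iff)

lemma attains_25_11: "attains_min_blocking 25 11"
  by (rule certified_config_attains_min_blocking[of _ _ 6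
    "[{0, 1, 2}, {0, 4, 6}, {1, 4, 5}, {2, 5, 6}, {0, 3, 5}, {2, 3, 4}, {1, 3, 7}, {7, 8, 9},
     {6, 8, 10}, {7, 14, 15}, {9, 15, 16}, {9, 11, 14}, {10, 11, 12}, {8, 12, 13},
     {13, 14, 16}, {11, 16, 17}, {10, 13, 17}, {12, 17, 18}, {15, 19, 20}, {19, 21, 24},
     {20, 21, 23}, {18, 23, 24}, {18, 21, 22}, {19, 22, 23}, {20, 22, 24}]"
    "{1, 3, 6, 9, 11, 12, 13, 15, 22, 23, 24}"]) code_simp

lemma attains_28_12_add: "attains_min_blocking (28 + 3 * n) (12 + n)"
  by (rule certified_config_attains_min_blocking_add[of _ _ 6
    "[{15, 16, 24}, {20, 21, 27}, {23, 25, 26}]"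
    "[{2, 3, 6}, {1, 3, 4}, {0, 4, 6}, {0, 1, 2}, {2, 4, 5}, {0, 3, 5}, {1, 5, 7}, {7, 8, 9},
     {9, 10, 13}, {8, 12, 13}, {7, 10, 12}, {8, 10, 11}, {9, 11, 12}, {11, 13, 14},
     {6, 14, 15}, {14, 16, 17}, {15, 21, 22}, {17, 22, 23}, {21, 23, 24}, {20, 24, 25},
     {16, 18, 20}, {17, 18, 19}, {19, 25, 27}, {18, 26, 27}, {19, 22, 26}]"
    "{0, 2, 3, 7, 11, 13, 15, 17, 20, 23, 26, 27}"])
    (code_simp, auto simp: pairwise_insert disjnt_iff)

section \<open>The two families\<close>

lemma attains_ceiling_plus_1:
  assumes "v \<ge> 8"
  shows "attains_min_blocking v ((v + 2) div 3 + 1)"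
proof -
  have "v \<in> {8, 9, 10, 11, 13} \<or>
      (\<exists>n. (v, (v + 2) div 3 + 1) \<in>
        {(12 + 3 * n, 5 + n), (14 + 3 * n, 6 + n), (16 + 3 * n, 7 + n)})"
    using assms unfolding insert_iff empty_iff prod.inject by presburger
  then show ?thesis
    using attains_8_4 attains_9_4 attains_10_5 attains_11_5 attains_13_6
      attains_12_5_add attains_14_6_add attains_16_7_add by auto
qed

lemma attains_ceiling_plus_2:
  assumes "v = 12 \<or> v \<ge> 15"
  shows "attains_min_blocking v ((v + 2) div 3 + 2)"
proof -
  have "v \<in> {12, 15, 16, 17, 19, 20, 22, 25} \<or>
      (\<exists>n. (v, (v + 2) div 3 + 2) \<in>
        {(18 + 3 * n, 8 + n), (23 + 3 * n, 10 + n), (28 + 3 * n, 12 + n)})"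
    using assms unfolding insert_iff empty_iff prod.inject by presburger
  then show ?thesis
    using attains_12_6 attains_15_7 attains_16_8 attains_17_8 attains_19_9 attains_20_9
      attains_22_10 attains_25_11 attains_18_8_add attains_23_10_add attains_28_12_add by auto
qed

lemma nat_ceiling_third: "nat \<lceil>real v / 3\<rceil> = (v + 2) div 3"
proof -
  have "\<lceil>real v / 3\<rceil> = - (- int v div 3)"
    using ceiling_divide_eq_div[of "int v" 3] by simp
  then show ?thesis by linarith
qed

theorem mainTheorem3:
  shows "(\<forall>v::nat. v \<ge> 8 \<longrightarrow>
            (\<exists>(P::nat set) B. sym_config_v3 P B v \<and> config_connected P B \<and>
               min_blocking_card P B (nat \<lceil>real v / 3\<rceil> + 1)))
       \<and> (\<forall>v::nat. (v = 12 \<or> v \<ge> 15) \<longrightarrow>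
            (\<exists>(P::nat set) B. sym_config_v3 P B v \<and> config_connected P B \<and>
               min_blocking_card P B (nat \<lceil>real v / 3\<rceil> + 2)))"
  using attains_ceiling_plus_1 attains_ceiling_plus_2
  unfolding attains_min_blocking_def nat_ceiling_third by blast

end
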